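(* Let $|\phi|<1$, $|\rho|<1$, $\sigma_\xi>0$, and let $(Y_t)_{t\ge 0}$ be a Markov DIG-AR(1) process with parameters $\phi,\rho,\sigma_\xi$ and innovations $(\xi_t)_{t\ge1}$. Then for every integer $k\ge 1$, the $k$-th order autocorrelation $\delta_{t,t+k}=\mathrm{corr}(\xi_t,\xi_{t+k})$ of the innovations satisfies $$\delta_{t,t+k}\longrightarrow\frac{\bar V^2(\rho,\phi)\,\bar\tau^{\,k-1}(\rho,\phi)}{\sigma_\xi^2}\,\bigl(\bar\tau(\rho,\phi)-\phi\bigr)\bigl(1-\phi\,\bar\tau(\rho,\phi)\bigr)\quad\text{as } t\to+\infty,$$ where $$\bar V(\rho,\phi)=\frac{\sigma_\xi\left(\rho\phi+\sqrt{\rho^2\phi^2+1-\phi^2}\right)}{1-\phi^2},\qquad \bar\tau(\rho,\phi)=\phi+\frac{\rho\,\sigma_\xi}{\bar V(\rho,\phi)}.$$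
   Context: A dependent innovations gaussian AR(1) process (DIG-AR(1)) with parameters $\phi,\rho,\sigma_\xi$ ($|\phi|<1$, $|\rho|<1$, $\sigma_\xi>0$) is a discrete-time real stochastic process on a probability space, $Y_t=\phi Y_{t-1}+\xi_t$ for $t\ge 1$, where $Y_0=0$ a.s., the $\xi_t$ (the innovations) are identically distributed (not assumed independent) with $\xi_t\sim N(0,\sigma_\xi^2)$ (variance $\sigma_\xi^2$), and for every $t$ the copula associated with $(\xi_t,Y_{t-1})$ is the gaussian copula with time-invariant parameter (correlation) $\rho$. For $t=1$ the copula condition is no restriction because $Y_0$ is constant. It is called a Markov DIG-AR(1) process if moreover $(Y_t)_t$ is a Markov process with respect to its own filtration. *)

theory Defs
  imports "HOL-Probability.Probability"
begin

section \<open>Gaussian copula\<close>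

text \<open>The quantile function takes values in the extended reals, so that it is \<open>-\<infinity>\<close> at \<open>0\<close>
  and \<open>\<infinity>\<close> at \<open>1\<close>; on \<open>]0, 1[\<close> it is the inverse of the normal distribution function.\<close>

definition std_normal_quantile :: "real \<Rightarrow> ereal" where
  "std_normal_quantile u = Inf {ereal x | x :: real. u \<le> cdf std_normal_distribution x}"

definition binormal_density :: "real \<Rightarrow> real \<times> real \<Rightarrow> real" where
  "binormal_density \<rho> = (\<lambda>(x, y).
     exp (- (x\<^sup>2 - 2 * \<rho> * x * y + y\<^sup>2) / (2 * (1 - \<rho>\<^sup>2))) / (2 * pi * sqrt (1 - \<rho>\<^sup>2)))"

definition binormal_cdf :: "real \<Rightarrow> ereal \<Rightarrow> ereal \<Rightarrow> real" where
  "binormal_cdf \<rho> a b =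
     measure (density lborel (binormal_density \<rho>)) {(x, y). ereal x \<le> a \<and> ereal y \<le> b}"

text \<open>Meaningful for \<open>\<bar>\<rho>\<bar> < 1\<close> and \<open>u, v \<in> [0, 1]\<close>. The extended quantiles yield the boundary
  values \<open>C(0, v) = C(u, 0) = 0\<close>, \<open>C(1, v) = v\<close>, \<open>C(u, 1) = u\<close>.\<close>

definition gaussian_copula :: "real \<Rightarrow> real \<Rightarrow> real \<Rightarrow> real" where
  "gaussian_copula \<rho> u v = binormal_cdf \<rho> (std_normal_quantile u) (std_normal_quantile v)"

text \<open>The relation of Sklar's theorem: \<open>C\<close> is a copula associated with \<open>(X, Y)\<close>. It determines
  \<open>C\<close> only on the product of the ranges of the marginal distribution functions; in particular,
  if \<open>X\<close> or \<open>Y\<close> is almost surely constant then it holds for every copula.\<close>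

definition (in prob_space) has_copula ::
    "('a \<Rightarrow> real) \<Rightarrow> ('a \<Rightarrow> real) \<Rightarrow> (real \<Rightarrow> real \<Rightarrow> real) \<Rightarrow> bool" where
  "has_copula X Y C \<longleftrightarrow> (\<forall>x y.
     prob {\<omega> \<in> space M. X \<omega> \<le> x \<and> Y \<omega> \<le> y} = C (cdf (distr M borel X) x) (cdf (distr M borel Y) y))"


section \<open>Markov processes and correlation\<close>

definition natural_filtration :: "'a measure \<Rightarrow> (nat \<Rightarrow> 'a \<Rightarrow> real) \<Rightarrow> nat \<Rightarrow> 'a measure" where
  "natural_filtration M Y t =
     sigma (space M) (\<Union>s\<le>t. sets (vimage_algebra (space M) (Y s) borel))"

definition markov_process :: "'a measure \<Rightarrow> (nat \<Rightarrow> 'a \<Rightarrow> real) \<Rightarrow> bool" where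
  "markov_process M Y \<longleftrightarrow> (\<forall>s t. s \<le> t \<longrightarrow> (\<forall>A \<in> sets borel. AE \<omega> in M.
     real_cond_exp M (natural_filtration M Y s) (\<lambda>\<omega>. indicator A (Y t \<omega>)) \<omega> =
     real_cond_exp M (vimage_algebra (space M) (Y s) borel) (\<lambda>\<omega>. indicator A (Y t \<omega>)) \<omega>))"

definition (in prob_space) covariance :: "('a \<Rightarrow> real) \<Rightarrow> ('a \<Rightarrow> real) \<Rightarrow> real" where
  "covariance X Y = expectation (\<lambda>\<omega>. (X \<omega> - expectation X) * (Y \<omega> - expectation Y))"

definition (in prob_space) correlation :: "('a \<Rightarrow> real) \<Rightarrow> ('a \<Rightarrow> real) \<Rightarrow> real" where
  "correlation X Y = covariance X Y / (sqrt (variance X) * sqrt (variance Y))"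


section \<open>DIG-AR(1) processes\<close>

text \<open>The innovations are \<open>\<xi> 1, \<xi> 2, \<dots>\<close>; the value \<open>\<xi> 0\<close> plays no role. Equations between random
  variables are understood almost surely. Note that \<open>normal_density\<close> is parametrized by the
  standard deviation.\<close>

locale DIG_AR1 = prob_space M for M :: "'a measure" +
  fixes Y \<xi> :: "nat \<Rightarrow> 'a \<Rightarrow> real" and \<phi> \<rho> \<sigma> :: real
  assumes phi: "\<bar>\<phi>\<bar> < 1"
    and rho: "\<bar>\<rho>\<bar> < 1"
    and sigma: "\<sigma> > 0"
    and random_variable_Y: "\<And>t. random_variable borel (Y t)"
    and Y_0: "AE \<omega> in M. Y 0 \<omega> = 0"
    and Y_step: "\<And>t. t \<ge> 1 \<Longrightarrow> AE \<omega> in M. Y t \<omega> = \<phi> * Y (t - 1) \<omega> + \<xi> t \<omega>"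
    and xi_normal: "\<And>t. t \<ge> 1 \<Longrightarrow> distributed M lborel (\<xi> t) (normal_density 0 \<sigma>)"
    and xi_Y_copula: "\<And>t. t \<ge> 1 \<Longrightarrow> has_copula (\<xi> t) (Y (t - 1)) (gaussian_copula \<rho>)"

locale markov_DIG_AR1 = DIG_AR1 +
  assumes markov: "markov_process M Y"

definition V_bar :: "real \<Rightarrow> real \<Rightarrow> real \<Rightarrow> real" where
  "V_bar \<sigma> \<rho> \<phi> = \<sigma> * (\<rho> * \<phi> + sqrt (\<rho>\<^sup>2 * \<phi>\<^sup>2 + 1 - \<phi>\<^sup>2)) / (1 - \<phi>\<^sup>2)"

definition tau_bar :: "real \<Rightarrow> real \<Rightarrow> real \<Rightarrow> real" where
  "tau_bar \<sigma> \<rho> \<phi> = \<phi> + \<rho> * \<sigma> / V_bar \<sigma> \<rho> \<phi>"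

end

theory Submission
  imports Defs
begin

text \<open>
  Write \<open>V\<^sub>t\<close> for the standard deviation of \<open>Y t\<close>.

  For a pair with normal marginals the gaussian copula says that the pair is jointly normal with
  correlation \<open>\<rho>\<close>. Equivalently, the innovation is a multiple of the present state plus independent noise,
  \<open>\<xi> (t + 1) = (\<rho> \<sigma> / V\<^sub>t) Y t + \<sigma> sqrt (1 - \<rho>\<^sup>2) W\<close> with \<open>W\<close> standard normal and independent of \<open>Y t\<close>
  (\<open>gaussian_copula_regression\<close>). Hence \<open>Y (t + 1) = \<tau>\<^sub>t Y t + \<sigma> sqrt (1 - \<rho>\<^sup>2) W\<close> with
  \<open>\<tau>\<^sub>t = \<phi> + \<rho> \<sigma> / V\<^sub>t\<close>. By induction every \<open>Y t\<close> with \<open>t \<ge> 1\<close> is a centred normal variable (\<open>Y_normal\<close>), and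
  \<open>V\<^sub>t\<close> satisfies a one-dimensional recursion. This recursion is a contraction with factor \<open>\<bar>\<phi>\<bar>\<close> and fixed
  point \<open>V_bar\<close> (\<open>dig_sd_tendsto\<close>); therefore \<open>V\<^sub>t\<close> tends to \<open>V_bar\<close> and \<open>\<tau>\<^sub>t\<close> to \<open>tau_bar\<close>.

  The noise \<open>W\<close> is independent of \<open>Y t\<close>, but nothing is said about its relation to the earlier states. This
  is where the Markov property enters: the conditional expectation of \<open>Y (t + 1)\<close> given the whole past equals
  that given \<open>Y t\<close> (\<open>markov_process_real_cond_exp\<close>), which is \<open>\<tau>\<^sub>t Y t\<close>. So
  \<open>E[Y s * Y (t + 1)] = \<tau>\<^sub>t E[Y s * Y t]\<close> for \<open>s \<le> t\<close>, and \<open>E[Y t * Y (t + j)]\<close> tends to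
  \<open>V_bar\<^sup>2 * tau_bar\<^sup>j\<close> (\<open>expectation_Y_mult_tendsto\<close>). Since \<open>\<xi> t = Y t - \<phi> Y (t - 1)\<close> almost surely, the
  autocorrelation of the innovations is a combination of four such moments, divided by \<open>\<sigma>\<^sup>2\<close>.
\<close>

section \<open>The bivariate normal law\<close>

text \<open>This is the factorization into the law of the second coordinate and the conditional law of the
first one given the second, \<open>N(\<rho> y, 1 - \<rho>\<^sup>2)\<close>: complete the square in \<open>x\<close>.\<close>

lemma binormal_density_conditional:
  assumes "\<bar>\<rho>\<bar> < 1"
  shows "binormal_density \<rho> (x, y) =
    normal_density (\<rho> * y) (sqrt (1 - \<rho>\<^sup>2)) x * std_normal_density y"
proof -
  have "\<rho>\<^sup>2 < 1"
    using assms by (simp add: abs_square_less_1)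
  then have "- (x - \<rho> * y)\<^sup>2 / (2 * (1 - \<rho>\<^sup>2)) - y\<^sup>2 / 2
      = - (x\<^sup>2 - 2 * \<rho> * x * y + y\<^sup>2) / (2 * (1 - \<rho>\<^sup>2))"
    by (simp add: divide_simps) (simp add: power2_eq_square algebra_simps)
  moreover have "sqrt (2 * pi * (1 - \<rho>\<^sup>2)) * sqrt (2 * pi) = 2 * pi * sqrt (1 - \<rho>\<^sup>2)"
    unfolding real_sqrt_mult[of "2 * pi"] by (simp add: mult.commute mult.left_commute)
  ultimately show ?thesis
    using \<open>\<rho>\<^sup>2 < 1\<close>
    by (simp add: binormal_density_def normal_density_def exp_add[symmetric] mult_exp_exp)
qed

text \<open>Since the conditional law of \<open>x\<close> given \<open>y\<close> is \<open>N(\<rho> y, 1 - \<rho>\<^sup>2)\<close>, the affine substitution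
\<open>x = \<rho> y + sqrt (1 - \<rho>\<^sup>2) w\<close> in the inner integral turns it into that of an independent standard
normal variable \<open>w\<close>. This also shows that the density has total mass 1.\<close>

lemma density_binormal_density:
  assumes "\<bar>\<rho>\<bar> < 1"
  shows "density lborel (binormal_density \<rho>) =
    distr (std_normal_distribution \<Otimes>\<^sub>M std_normal_distribution) borel
      (\<lambda>(w, y). (\<rho> * y + sqrt (1 - \<rho>\<^sup>2) * w, y))"
    (is "?L = distr (?N \<Otimes>\<^sub>M ?N) borel ?T")
proof (rule measure_eqI)
  define s where "s = sqrt (1 - \<rho>\<^sup>2)"
  have "s > 0"
    using assms by (simp add: s_def abs_square_less_1)
  have N: "?N \<Otimes>\<^sub>M ?N
      = density (lborel \<Otimes>\<^sub>M lborel) (\<lambda>(w, y). ennreal (std_normal_density w) * ennreal (std_normal_density y))"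
    by (rule pair_measure_density)
      (auto intro: sigma_finite_lborel prob_space_imp_sigma_finite prob_space_normal_density[of 1 0, simplified])
  have T[measurable]: "?T \<in> borel_measurable (borel \<Otimes>\<^sub>M borel)"
    by measurable
  have m[measurable]: "binormal_density \<rho> \<in> borel_measurable (borel \<Otimes>\<^sub>M borel)"
    unfolding binormal_density_def by measurable
  show "sets ?L = sets (distr (?N \<Otimes>\<^sub>M ?N) borel ?T)"
    by simp
  fix A assume "A \<in> sets ?L"
  then have A: "A \<in> sets borel"
    by simp
  then have [measurable]: "A \<in> sets (borel \<Otimes>\<^sub>M borel)"
    unfolding borel_prod .
  have "emeasure ?L A = (\<integral>\<^sup>+z. ennreal (binormal_density \<rho> z) * indicator A z \<partial>(lborel \<Otimes>\<^sub>M lborel))"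
    using A m by (subst emeasure_density) (auto simp: lborel_prod borel_prod)
  also have "\<dots> = (\<integral>\<^sup>+y. \<integral>\<^sup>+x. ennreal (binormal_density \<rho> (x, y)) * indicator A (x, y) \<partial>lborel \<partial>lborel)"
    by (subst lborel_pair.nn_integral_snd[symmetric]) auto
  also have "\<dots> = (\<integral>\<^sup>+y. \<integral>\<^sup>+w. ennreal (std_normal_density w) * ennreal (std_normal_density y)
      * indicator A (?T (w, y)) \<partial>lborel \<partial>lborel)"
  proof (rule nn_integral_cong)
    fix y :: real
    have s: "s * normal_density (\<rho> * y) s (\<rho> * y + s * w) = std_normal_density w" for w
      using \<open>s > 0\<close> by (simp add: normal_density_def real_sqrt_mult power_mult_distrib)
    have "(\<integral>\<^sup>+x. ennreal (binormal_density \<rho> (x, y)) * indicator A (x, y) \<partial>lborel)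
      = ennreal s * (\<integral>\<^sup>+w. ennreal (binormal_density \<rho> (\<rho> * y + s * w, y))
          * indicator A (\<rho> * y + s * w, y) \<partial>lborel)"
      using \<open>s > 0\<close> by (subst nn_integral_real_affine[where c = s and t = "\<rho> * y"]) auto
    also have "\<dots> = (\<integral>\<^sup>+w. ennreal s * (ennreal (binormal_density \<rho> (\<rho> * y + s * w, y))
          * indicator A (\<rho> * y + s * w, y)) \<partial>lborel)"
      by (rule nn_integral_cmult[symmetric]) measurable
    also have "\<dots> = (\<integral>\<^sup>+w. ennreal (std_normal_density w) * ennreal (std_normal_density y)
      * indicator A (?T (w, y)) \<partial>lborel)"
    proof (rule nn_integral_cong)
      fix w :: real
      have "ennreal s * ennreal (binormal_density \<rho> (\<rho> * y + s * w, y))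
          = ennreal (std_normal_density w) * ennreal (std_normal_density y)"
        using \<open>s > 0\<close> by (simp add: binormal_density_conditional[OF assms] s_def[symmetric] s
          ennreal_mult[symmetric] mult.assoc[symmetric])
      then show "ennreal s * (ennreal (binormal_density \<rho> (\<rho> * y + s * w, y))
          * indicator A (\<rho> * y + s * w, y)) =
        ennreal (std_normal_density w) * ennreal (std_normal_density y) * indicator A (?T (w, y))"
        by (simp add: s_def mult.assoc[symmetric])
    qed
    finally show "(\<integral>\<^sup>+x. ennreal (binormal_density \<rho> (x, y)) * indicator A (x, y) \<partial>lborel)
      = (\<integral>\<^sup>+w. ennreal (std_normal_density w) * ennreal (std_normal_density y)
      * indicator A (?T (w, y)) \<partial>lborel)" .
  qed
  also have "\<dots> = (\<integral>\<^sup>+z. (case z of (w, y) \<Rightarrow> ennreal (std_normal_density w) * ennreal (std_normal_density y))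
      * indicator A (?T z) \<partial>(lborel \<Otimes>\<^sub>M lborel))"
    by (subst lborel_pair.nn_integral_snd[symmetric]) auto
  also have "\<dots> = (\<integral>\<^sup>+z. indicator A (?T z) \<partial>(?N \<Otimes>\<^sub>M ?N))"
    unfolding N by (subst nn_integral_density) (auto simp: split_beta')
  also have "\<dots> = (\<integral>\<^sup>+z. indicator A z \<partial>distr (?N \<Otimes>\<^sub>M ?N) borel ?T)"
    using A T by (subst nn_integral_distr) (auto simp: borel_prod N)
  also have "\<dots> = emeasure (distr (?N \<Otimes>\<^sub>M ?N) borel ?T) A"
    using A by simp
  finally show "emeasure ?L A = emeasure (distr (?N \<Otimes>\<^sub>M ?N) borel ?T) A" .
qed

section \<open>From the gaussian copula to the joint law\<close>

text \<open>The density is positive everywhere, so that no interval of positive length is a null set.\<close>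

lemma strict_mono_cdf_std_normal: "strict_mono (cdf std_normal_distribution)"
proof (rule strict_monoI)
  fix x y :: real assume "x < y"
  interpret N: real_distribution std_normal_distribution
    by (rule real_dist_normal_dist)
  have "N.prob {x<..y} \<noteq> 0"
  proof
    assume "N.prob {x<..y} = 0"
    then have "{x<..y} \<in> null_sets std_normal_distribution"
      by (simp add: N.emeasure_eq_measure null_sets_def)
    moreover have "ennreal (std_normal_density z) \<noteq> 0" for z
      using normal_density_pos[of 1 0 z] by (simp add: ennreal_eq_0_iff not_le)
    ultimately have "AE z in lborel. z \<notin> {x<..y}"
      by (simp add: null_sets_density_iff)
    then have "{x<..y} \<in> null_sets lborel"
      by (subst (asm) AE_iff_null_sets[symmetric]) auto
    then show False
      using \<open>x < y\<close> by (simp add: null_sets_def)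
  qed
  moreover have "cdf std_normal_distribution y - cdf std_normal_distribution x = N.prob {x<..y}"
    using \<open>x < y\<close> by (rule N.cdf_diff_eq)
  ultimately show "cdf std_normal_distribution x < cdf std_normal_distribution y"
    using measure_nonneg[of std_normal_distribution "{x<..y}"] by linarith
qed

lemma std_normal_quantile_cdf: "std_normal_quantile (cdf std_normal_distribution x) = ereal x"
  unfolding std_normal_quantile_def strict_mono_less_eq[OF strict_mono_cdf_std_normal]
  by (rule antisym) (auto intro: Inf_lower Inf_greatest)

lemma (in prob_space) cdf_distr_normal:
  assumes "distributed M lborel X (normal_density 0 \<sigma>)" and "\<sigma> > 0"
  shows "cdf (distr M borel X) x = cdf std_normal_distribution (x / \<sigma>)"
proof -
  have X[measurable]: "random_variable borel X"
    using distributed_measurable[OF assms(1)] by simp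
  have "distributed M lborel (\<lambda>\<omega>. X \<omega> / \<sigma>) std_normal_density"
    using assms normal_standard_normal_convert[of \<sigma> X 0] by simp
  then have "std_normal_distribution = distr M borel (\<lambda>\<omega>. X \<omega> / \<sigma>)"
    by (simp add: distributed_def cong: distr_cong)
  then show ?thesis
    using \<open>\<sigma> > 0\<close> by (simp add: cdf_def measure_distr vimage_def divide_le_cancel)
qed

text \<open>The lower left quadrants are the sets \<open>{..p}\<close> of the componentwise order on the plane; they
generate the Borel sets and are closed under intersection.\<close>

lemma borel_prod_measure_eqI_atMost:
  fixes L K :: "(real \<times> real) measure"
  assumes "prob_space K" and sets: "sets L = sets borel" "sets K = sets borel"
    and eq: "\<And>x y. emeasure K ({..x} \<times> {..y}) = emeasure L ({..x} \<times> {..y})"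
  shows "K = L"
proof -
  interpret prob_space K by fact
  have Iic: "{..p} = {..fst p} \<times> {..snd p}" for p :: "real \<times> real"
    by (auto simp: less_eq_prod_def)
  show ?thesis
  proof (rule measure_eqI_generator_eq[where E = "range atMost" and \<Omega> = UNIV
        and A = "\<lambda>n. {..(real n, real n)}"])
    show "Int_stable (range (atMost :: real \<times> real \<Rightarrow> _))"
      by (auto simp: Int_stable_def Iic Times_Int_Times image_iff intro!: exI[of _ "(min _ _, min _ _)"])
    show "emeasure K X = emeasure L X" if "X \<in> range atMost" for X
      using that eq by (auto simp: Iic)
    show "sets L = sigma_sets UNIV (range atMost)" "sets K = sigma_sets UNIV (range atMost)"
      using sets by (simp_all add: borel_eq_atMost)
    show "(\<Union>n. {..(real n, real n)}) = UNIV"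
    proof (rule UNIV_eq_I[symmetric])
      fix p :: "real \<times> real"
      obtain n :: nat where "max (fst p) (snd p) \<le> n"
        using real_arch_simple by blast
      then show "p \<in> (\<Union>n. {..(real n, real n)})"
        by (auto simp: Iic intro!: exI[of _ n] mem_Times_iff[THEN iffD2])
    qed
  qed auto
qed

text \<open>With continuous marginals the relation of Sklar's theorem determines the joint distribution
function: the quantile function undoes the marginal distribution functions, and what remains is
the distribution function of the bivariate normal law at the normalized arguments.\<close>

lemma (in prob_space) gaussian_copula_joint_law:
  assumes X: "distributed M lborel X (normal_density 0 \<sigma>)" and "\<sigma> > 0"
    and Y: "distributed M lborel Y (normal_density 0 v)" and "v > 0"
    and C: "has_copula X Y (gaussian_copula \<rho>)" and "\<bar>\<rho>\<bar> < 1"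
  shows "distr M borel (\<lambda>\<omega>. (X \<omega> / \<sigma>, Y \<omega> / v)) = density lborel (binormal_density \<rho>)"
proof (rule borel_prod_measure_eqI_atMost)
  have [measurable]: "random_variable borel X" "random_variable borel Y"
    using distributed_measurable[OF X] distributed_measurable[OF Y] by simp_all
  have m: "random_variable borel (\<lambda>\<omega>. (X \<omega> / \<sigma>, Y \<omega> / v))"
    unfolding borel_prod[symmetric] by measurable
  show "prob_space (distr M borel (\<lambda>\<omega>. (X \<omega> / \<sigma>, Y \<omega> / v)))"
    using m by (rule prob_space_distr)
  interpret N: prob_space std_normal_distribution
    by (simp add: prob_space_normal_density)
  interpret NN: pair_prob_space std_normal_distribution std_normal_distribution ..
  interpret L: prob_space "density lborel (binormal_density \<rho>)"
    unfolding density_binormal_density[OF \<open>\<bar>\<rho>\<bar> < 1\<close>] by (rule NN.prob_space_distr) (simp add: borel_prod[symmetric])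
  fix x y :: real
  have Q: "{..x} \<times> {..y} \<in> sets borel"
    unfolding borel_prod[symmetric] by measurable
  have "prob {\<omega> \<in> space M. X \<omega> \<le> \<sigma> * x \<and> Y \<omega> \<le> v * y} = binormal_cdf \<rho> (ereal x) (ereal y)"
    using C \<open>\<sigma> > 0\<close> \<open>v > 0\<close>
    by (simp add: has_copula_def gaussian_copula_def std_normal_quantile_cdf
      cdf_distr_normal[OF X] cdf_distr_normal[OF Y])
  moreover have "(\<lambda>\<omega>. (X \<omega> / \<sigma>, Y \<omega> / v)) -` ({..x} \<times> {..y}) \<inter> space M
      = {\<omega> \<in> space M. X \<omega> \<le> \<sigma> * x \<and> Y \<omega> \<le> v * y}"
    using \<open>\<sigma> > 0\<close> \<open>v > 0\<close> by (auto simp: divide_le_eq mult.commute)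
  moreover have "{(x', y'). ereal x' \<le> ereal x \<and> ereal y' \<le> ereal y} = {..x} \<times> {..y}"
    by auto
  ultimately show "emeasure (distr M borel (\<lambda>\<omega>. (X \<omega> / \<sigma>, Y \<omega> / v))) ({..x} \<times> {..y})
      = emeasure (density lborel (binormal_density \<rho>)) ({..x} \<times> {..y})"
    by (simp add: emeasure_distr[OF m Q] emeasure_eq_measure L.emeasure_eq_measure binormal_cdf_def)
qed auto

text \<open>The gaussian copula is only used through this regression of \<open>X\<close> on \<open>Y\<close>. The residual \<open>W\<close> is obtained
by inverting the affine map that produces the bivariate normal law from a pair of independent
standard normal variables, so that \<open>(W, Y / v)\<close> is distributed as such a pair.\<close>

lemma (in prob_space) gaussian_copula_regression:
  assumes X: "distributed M lborel X (normal_density 0 \<sigma>)" and "\<sigma> > 0"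
    and Y: "distributed M lborel Y (normal_density 0 v)" and "v > 0"
    and C: "has_copula X Y (gaussian_copula \<rho>)" and "\<bar>\<rho>\<bar> < 1"
  obtains W where "indep_var borel W borel Y" "distributed M lborel W std_normal_density"
    "\<And>\<omega>. X \<omega> = \<rho> * \<sigma> / v * Y \<omega> + \<sigma> * sqrt (1 - \<rho>\<^sup>2) * W \<omega>"
proof -
  define s where "s = sqrt (1 - \<rho>\<^sup>2)"
  have "s > 0"
    using \<open>\<bar>\<rho>\<bar> < 1\<close> by (simp add: s_def abs_square_less_1)
  define W where "W \<omega> = (X \<omega> / \<sigma> - \<rho> * (Y \<omega> / v)) / s" for \<omega>
  have [measurable]: "random_variable borel X" "random_variable borel Y"
    using distributed_measurable[OF X] distributed_measurable[OF Y] by simp_all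
  have W[measurable]: "random_variable borel W"
    unfolding W_def by measurable
  let ?N = std_normal_distribution
  interpret N: prob_space ?N
    by (simp add: prob_space_normal_density)
  interpret NN: pair_prob_space ?N ?N ..
  have NN: "distr M (borel \<Otimes>\<^sub>M borel) (\<lambda>\<omega>. (W \<omega>, Y \<omega> / v)) = ?N \<Otimes>\<^sub>M ?N"
  proof -
    have "distr M (borel \<Otimes>\<^sub>M borel) (\<lambda>\<omega>. (W \<omega>, Y \<omega> / v)) =
      distr (distr M (borel \<Otimes>\<^sub>M borel) (\<lambda>\<omega>. (X \<omega> / \<sigma>, Y \<omega> / v))) (borel \<Otimes>\<^sub>M borel)
        (\<lambda>(x, y). ((x - \<rho> * y) / s, y))"
      by (simp add: distr_distr comp_def W_def)
    also have "\<dots> = distr (?N \<Otimes>\<^sub>M ?N) (borel \<Otimes>\<^sub>M borel) (\<lambda>z. z)"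
      unfolding borel_prod gaussian_copula_joint_law[OF assms] density_binormal_density[OF \<open>\<bar>\<rho>\<bar> < 1\<close>]
      unfolding borel_prod[symmetric] s_def[symmetric]
      using \<open>s > 0\<close> by (subst distr_distr) (auto simp: comp_def split_beta')
    also have "\<dots> = ?N \<Otimes>\<^sub>M ?N"
      by (rule distr_id2) (simp cong: sets_pair_measure_cong)
    finally show ?thesis .
  qed
  have "distr M borel W = distr (?N \<Otimes>\<^sub>M ?N) borel fst"
    by (simp add: NN[symmetric] distr_distr comp_def)
  also have "\<dots> = distr (?N \<Otimes>\<^sub>M ?N) ?N fst"
    by (rule distr_cong) simp_all
  finally have dW: "distr M borel W = ?N"
    by (simp add: N.distr_pair_fst)
  have "distributed M lborel (\<lambda>\<omega>. Y \<omega> / v) std_normal_density"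
    using Y \<open>v > 0\<close> normal_standard_normal_convert[of v Y 0] by simp
  then have dY: "distr M borel (\<lambda>\<omega>. Y \<omega> / v) = ?N"
    by (simp add: distributed_def cong: distr_cong)
  have "indep_var borel W borel (\<lambda>\<omega>. Y \<omega> / v)"
    unfolding indep_var_distribution_eq by (simp add: NN dW dY)
  then have "indep_var borel ((\<lambda>w. w) \<circ> W) borel ((\<lambda>y. v * y) \<circ> (\<lambda>\<omega>. Y \<omega> / v))"
    by (rule indep_var_compose) measurable
  then have "indep_var borel W borel Y"
    using \<open>v > 0\<close> by (simp add: comp_def)
  moreover have "distributed M lborel W std_normal_density"
    using dW by (simp add: distributed_def cong: distr_cong)
  moreover have "X \<omega> = \<rho> * \<sigma> / v * Y \<omega> + \<sigma> * s * W \<omega>" for \<omega>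
    using \<open>s > 0\<close> \<open>\<sigma> > 0\<close> by (simp add: W_def field_simps)
  ultimately show thesis
    using that unfolding s_def by blast
qed

text \<open>The coefficient \<open>a\<close> may vanish; this case is separate because \<open>normal_density\<close> does not describe
the law of the constant \<open>0\<close>.\<close>

lemma (in prob_space) indep_normal_lincomb:
  assumes "indep_var borel W borel Y" and W: "distributed M lborel W std_normal_density"
    and Y: "distributed M lborel Y (normal_density 0 v)" and "v > 0" and "b > 0"
  shows "distributed M lborel (\<lambda>\<omega>. a * Y \<omega> + b * W \<omega>) (normal_density 0 (sqrt ((a * v)\<^sup>2 + b\<^sup>2)))"
proof -
  have bW: "distributed M lborel (\<lambda>\<omega>. b * W \<omega>) (normal_density 0 b)"
    using normal_density_affine[OF W, of b 0] \<open>b > 0\<close> by simp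
  show ?thesis
  proof (cases "a = 0")
    case True
    with bW \<open>b > 0\<close> show ?thesis by simp
  next
    case False
    have aY: "distributed M lborel (\<lambda>\<omega>. a * Y \<omega>) (normal_density 0 (\<bar>a\<bar> * v))"
      using normal_density_affine[OF Y, of a 0] \<open>v > 0\<close> False by simp
    have "indep_var borel ((\<lambda>w. b * w) \<circ> W) borel ((\<lambda>y. a * y) \<circ> Y)"
      using assms(1) by (rule indep_var_compose) measurable
    then have "distributed M lborel (\<lambda>\<omega>. b * W \<omega> + a * Y \<omega>)
        (normal_density (0 + 0) (sqrt (b\<^sup>2 + (\<bar>a\<bar> * v)\<^sup>2)))"
      using False \<open>v > 0\<close> \<open>b > 0\<close> by (intro add_indep_normal bW aY) (auto simp: comp_def)
    then show ?thesis
      by (simp add: add.commute power_mult_distrib)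
  qed
qed

lemma (in prob_space) normal_integrable_power2:
  assumes X: "distributed M lborel X (normal_density 0 v)" and "v > 0"
  shows "integrable M X" and "integrable M (\<lambda>\<omega>. (X \<omega>)\<^sup>2)" and "expectation (\<lambda>\<omega>. (X \<omega>)\<^sup>2) = v\<^sup>2"
proof -
  have [measurable]: "random_variable borel X"
    using distributed_measurable[OF X] by simp
  show sq: "integrable M (\<lambda>\<omega>. (X \<omega>)\<^sup>2)"
    using integrable_normal_moment[OF \<open>v > 0\<close>, of 0 2] distributed_integrable[OF X, of "\<lambda>x. x\<^sup>2"] by simp
  then show "integrable M X"
    by (rule square_integrable_imp_integrable[rotated]) simp
  show "expectation (\<lambda>\<omega>. (X \<omega>)\<^sup>2) = v\<^sup>2"
    using normal_distributed_variance[OF \<open>v > 0\<close> X] normal_distributed_expectation[OF \<open>v > 0\<close> X] by simp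
qed

section \<open>Conditional expectations\<close>

text \<open>A centred \<open>W\<close> that is independent of \<open>Y\<close> integrates to zero over each event \<open>Y \<in> B\<close>, and these events
make up the \<open>\<sigma>\<close>-algebra generated by \<open>Y\<close>.\<close>

lemma (in prob_space) cond_exp_indep_remainder:
  assumes "indep_var borel W borel Y" and "integrable M W" and "expectation W = 0" and "integrable M Y"
  shows "AE \<omega> in M. real_cond_exp M (vimage_algebra (space M) Y borel) (\<lambda>\<omega>. a * Y \<omega> + b * W \<omega>) \<omega> = a * Y \<omega>"
proof -
  let ?G = "vimage_algebra (space M) Y borel"
  have [measurable]: "random_variable borel W" "random_variable borel Y"
    using indep_var_rv1 indep_var_rv2 assms(1) by blast+
  have YG[measurable]: "Y \<in> borel_measurable ?G"
    by (rule measurable_vimage_algebra1) simp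
  interpret G: finite_measure_subalgebra M ?G
    by unfold_locales (auto simp: subalgebra_def sets_vimage_algebra2)
  show ?thesis
  proof (rule G.real_cond_exp_charact)
    fix A assume "A \<in> sets ?G"
    then obtain B where B: "B \<in> sets borel" "A = Y -` B \<inter> space M"
      by (auto simp: sets_vimage_algebra2)
    have [measurable]: "A \<in> sets M" "B \<in> sets borel"
      using B by auto
    have "indep_var borel ((\<lambda>w. w) \<circ> W) borel (indicator B \<circ> Y :: _ \<Rightarrow> real)"
      using assms(1) by (rule indep_var_compose) measurable
    then have "expectation (\<lambda>\<omega>. W \<omega> * indicator B (Y \<omega>)) = expectation W * expectation (\<lambda>\<omega>. indicator B (Y \<omega>))"
      using assms(2) by (subst indep_var_lebesgue_integral)
        (auto simp: comp_def intro: integrable_const_bound[where B = 1])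
    moreover have "expectation (\<lambda>\<omega>. W \<omega> * indicator B (Y \<omega>)) = (\<integral>\<omega>\<in>A. W \<omega> \<partial>M)"
      unfolding set_lebesgue_integral_def
      by (rule Bochner_Integration.integral_cong) (auto simp: B indicator_def)
    ultimately have "(\<integral>\<omega>\<in>A. W \<omega> \<partial>M) = 0"
      using assms(3) by simp
    moreover have "set_integrable M A W" "set_integrable M A Y"
      unfolding set_integrable_def
      using integrable_mult_indicator[OF \<open>A \<in> sets M\<close>] assms(2,4) by blast+
    ultimately show "(\<integral>\<omega>\<in>A. a * Y \<omega> + b * W \<omega> \<partial>M) = (\<integral>\<omega>\<in>A. a * Y \<omega> \<partial>M)"
      by (subst set_integral_add) auto
  qed (use assms in auto)
qed

text \<open>Conditional expectation is self-adjoint: both integrals equal the integral of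
\<open>E[1\<^sub>B | F] * E[f | F]\<close>. Restricting one factor to an indicator, whose conditional expectation is
bounded by 1, lets the other one be any integrable function.\<close>

lemma (in finite_measure_subalgebra) real_cond_exp_indicator_swap:
  assumes "B \<in> sets M" and f: "integrable M f"
  shows "integrable M (\<lambda>x. real_cond_exp M F (indicator B) x * f x)"
    and "(\<integral>x. real_cond_exp M F (indicator B) x * f x \<partial>M) = (\<integral>x. indicator B x * real_cond_exp M F f x \<partial>M)"
proof -
  note [measurable] = \<open>B \<in> sets M\<close> borel_measurable_integrable[OF f]
  let ?p = "real_cond_exp M F (indicator B)"
  have iB: "integrable M (indicator B :: _ \<Rightarrow> real)"
    using assms by (auto intro: integrable_const_bound[where B = 1])
  have "AE x in M. ?p x \<ge> 0" "AE x in M. ?p x \<le> 1"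
    by (rule real_cond_exp_pos, auto) (rule real_cond_exp_le_c[OF iB], auto simp: indicator_def)
  then have "AE x in M. norm (?p x * f x) \<le> norm (f x)"
    by eventually_elim (simp add: abs_mult mult_left_le_one_le)
  then show *: "integrable M (\<lambda>x. ?p x * f x)"
    by (intro Bochner_Integration.integrable_bound[OF f]) measurable
  have "(\<integral>x. ?p x * f x \<partial>M) = (\<integral>x. ?p x * real_cond_exp M F f x \<partial>M)"
    using * by (rule real_cond_exp_intg(2)[symmetric]) measurable
  also have "\<dots> = (\<integral>x. real_cond_exp M F f x * indicator B x \<partial>M)"
    using real_cond_exp_intg(2)[of "real_cond_exp M F f" "indicator B"]
      integrable_mult_indicator[OF \<open>B \<in> sets M\<close> real_cond_exp_int(1)[OF f]]
    by (simp add: mult.commute)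
  finally show "(\<integral>x. ?p x * f x \<partial>M) = (\<integral>x. indicator B x * real_cond_exp M F f x \<partial>M)"
    by (simp add: mult.commute)
qed

lemma (in prob_space) sets_natural_filtration:
  assumes [measurable]: "\<And>t. random_variable borel (Y t)"
  shows "sets (natural_filtration M Y s) =
    sigma_sets (space M) (\<Union>u\<le>s. sets (vimage_algebra (space M) (Y u) borel))"
  unfolding natural_filtration_def
  by (rule sets_measure_of) (auto simp: sets_vimage_algebra2)

lemma (in prob_space) subalgebra_natural_filtration:
  assumes [measurable]: "\<And>t. random_variable borel (Y t)"
  shows "subalgebra M (natural_filtration M Y s)"
proof -
  have "(\<Union>u\<le>s. sets (vimage_algebra (space M) (Y u) borel)) \<subseteq> sets M"
    by (auto simp: sets_vimage_algebra2)
  then have "sets (natural_filtration M Y s) \<subseteq> sets M"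
    unfolding sets_natural_filtration[OF assms] by (rule sets.sigma_sets_subset)
  then show ?thesis
    by (simp add: subalgebra_def natural_filtration_def space_measure_of_conv)
qed

lemma (in prob_space) measurable_natural_filtration:
  assumes "\<And>t. random_variable borel (Y t)" and "s \<le> t"
  shows "Y s \<in> borel_measurable (natural_filtration M Y t)"
proof (rule measurable_from_subalg)
  have "space (natural_filtration M Y t) = space M"
    by (simp add: natural_filtration_def space_measure_of_conv)
  then show "subalgebra (natural_filtration M Y t) (vimage_algebra (space M) (Y s) borel)"
    using assms by (auto simp: subalgebra_def sets_natural_filtration)
  show "Y s \<in> borel_measurable (vimage_algebra (space M) (Y s) borel)"
    by (rule measurable_vimage_algebra1) simp
qed

text \<open>The Markov property speaks of indicators of \<open>Y t\<close>; here it is extended to \<open>Y t\<close> itself. Let \<open>F\<close> be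
the past up to time \<open>s\<close>, let \<open>G\<close> be generated by \<open>Y s\<close>, let \<open>B \<in> F\<close> and \<open>p = E[1\<^sub>B | G]\<close>. By
self-adjointness, the Markov property for all Borel sets \<open>A\<close> gives that the image under \<open>Y t\<close> of the
measure with density \<open>p\<close> and that of the measure with density \<open>1\<^sub>B\<close> coincide. Equal measures have
equal first moments, hence \<open>E[p * Y t] = E[1\<^sub>B * Y t]\<close>; moving the conditional expectation back to
\<open>Y t\<close> gives the defining property of \<open>E[Y t | F]\<close>.\<close>

lemma (in prob_space) markov_process_real_cond_exp:
  assumes "markov_process M Y" and Y: "\<And>t. random_variable borel (Y t)"
    and "s \<le> t" and int: "integrable M (Y t)"
  shows "AE \<omega> in M. real_cond_exp M (natural_filtration M Y s) (Y t) \<omega> =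
    real_cond_exp M (vimage_algebra (space M) (Y s) borel) (Y t) \<omega>"
proof -
  let ?F = "natural_filtration M Y s" and ?G = "vimage_algebra (space M) (Y s) borel"
  note [measurable] = Y
  have YM: "sets ?G \<subseteq> sets M"
    by (auto simp: sets_vimage_algebra2)
  have F: "subalgebra M ?F"
    using Y by (rule subalgebra_natural_filtration)
  have GF: "subalgebra ?F ?G"
    using F Y by (auto simp: subalgebra_def sets_natural_filtration)
  interpret F: finite_measure_subalgebra M ?F
    by unfold_locales (rule F)
  interpret G: finite_measure_subalgebra M ?G
    by unfold_locales (simp add: subalgebra_def YM)
  show ?thesis
  proof (rule F.real_cond_exp_charact)
    fix B assume "B \<in> sets ?F"
    then have B[measurable]: "B \<in> sets M"
      using F by (auto simp: subalgebra_def)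
    let ?p = "real_cond_exp M ?G (indicator B)"
    have p_pos: "AE \<omega> in M. 0 \<le> ?p \<omega>"
      by (rule G.real_cond_exp_pos) auto
    \<comment> \<open>The Markov property enters through this equality of measures on the line.\<close>
    have law: "distr (density M ?p) borel (Y t) = distr (density M (indicator B :: 'a \<Rightarrow> real)) borel (Y t)"
    proof (rule measure_eqI)
      fix A assume "A \<in> sets (distr (density M ?p) borel (Y t))"
      then have A[measurable]: "A \<in> sets borel"
        by simp
      let ?I = "\<lambda>\<omega>. indicator A (Y t \<omega>) :: real"
      have iI: "integrable M ?I"
        by (rule integrable_const_bound[where B = 1]) auto
      have em: "emeasure (distr (density M q) borel (Y t)) A = ennreal (\<integral>\<omega>. q \<omega> * ?I \<omega> \<partial>M)"
        if [measurable]: "q \<in> borel_measurable M" and "AE \<omega> in M. 0 \<le> q \<omega>" "integrable M (\<lambda>\<omega>. q \<omega> * ?I \<omega>)"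
        for q :: "'a \<Rightarrow> real"
      proof -
        have "emeasure (distr (density M q) borel (Y t)) A
            = (\<integral>\<^sup>+\<omega>. ennreal (q \<omega>) * indicator (Y t -` A \<inter> space M) \<omega> \<partial>M)"
          by (simp add: emeasure_distr emeasure_density)
        also have "\<dots> = (\<integral>\<^sup>+\<omega>. ennreal (q \<omega> * ?I \<omega>) \<partial>M)"
          by (rule nn_integral_cong) (auto simp: indicator_def)
        also have "\<dots> = ennreal (\<integral>\<omega>. q \<omega> * ?I \<omega> \<partial>M)"
        proof (rule nn_integral_eq_integral)
          show "AE \<omega> in M. 0 \<le> q \<omega> * ?I \<omega>"
            using that(2) by eventually_elim simp
        qed fact
        finally show ?thesis .
      qed
      have "(\<integral>\<omega>. ?p \<omega> * ?I \<omega> \<partial>M) = (\<integral>\<omega>. indicator B \<omega> * real_cond_exp M ?G ?I \<omega> \<partial>M)"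
        by (rule G.real_cond_exp_indicator_swap(2)[OF B iI])
      also have "\<dots> = (\<integral>\<omega>. indicator B \<omega> * real_cond_exp M ?F ?I \<omega> \<partial>M)"
      proof (rule integral_cong_AE)
        have "AE \<omega> in M. real_cond_exp M ?F ?I \<omega> = real_cond_exp M ?G ?I \<omega>"
          using assms(1) \<open>s \<le> t\<close> A unfolding markov_process_def by blast
        then show "AE \<omega> in M. indicator B \<omega> * real_cond_exp M ?G ?I \<omega> = indicator B \<omega> * real_cond_exp M ?F ?I \<omega>"
          by eventually_elim simp
      qed measurable
      also have "\<dots> = (\<integral>\<omega>. indicator B \<omega> * ?I \<omega> \<partial>M)"
        using F.real_cond_exp_intA[OF iI \<open>B \<in> sets ?F\<close>] by (simp add: set_lebesgue_integral_def)
      finally show "emeasure (distr (density M ?p) borel (Y t)) A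
          = emeasure (distr (density M (indicator B :: 'a \<Rightarrow> real)) borel (Y t)) A"
        using G.real_cond_exp_indicator_swap(1)[OF B iI] integrable_mult_indicator[OF B iI] p_pos
        by (subst (1 2) em) auto
    qed simp
    have "(\<integral>\<omega>\<in>B. real_cond_exp M ?G (Y t) \<omega> \<partial>M) = (\<integral>\<omega>. ?p \<omega> * Y t \<omega> \<partial>M)"
      by (simp add: set_lebesgue_integral_def G.real_cond_exp_indicator_swap(2)[OF B int])
    also have "\<dots> = (\<integral>y. y \<partial>distr (density M ?p) borel (Y t))"
      using p_pos by (simp add: integral_distr integral_density)
    also have "\<dots> = (\<integral>\<omega>\<in>B. Y t \<omega> \<partial>M)"
      unfolding law by (simp add: integral_distr integral_density set_lebesgue_integral_def)
    finally show "(\<integral>\<omega>\<in>B. Y t \<omega> \<partial>M) = (\<integral>\<omega>\<in>B. real_cond_exp M ?G (Y t) \<omega> \<partial>M)" ..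
  qed (auto intro: int G.real_cond_exp_int(1) measurable_from_subalg[OF GF])
qed

section \<open>The standard deviations and their limit\<close>

text \<open>The standard deviation \<open>V\<^sub>t\<close> of \<open>Y t\<close>. The radicand equals
\<open>\<phi>\<^sup>2 V\<^sub>t\<^sup>2 + 2 \<phi> \<rho> \<sigma> V\<^sub>t + \<sigma>\<^sup>2\<close>; written as a sum of two squares it separates the contribution of \<open>Y t\<close>
from that of the independent residual of \<open>\<xi> (t + 1)\<close>, and it is visibly positive. Starting at \<open>0\<close> gives
\<open>V\<^sub>1 = \<sigma>\<close>, in accordance with \<open>Y 1 = \<xi> 1\<close>.\<close>

primrec dig_sd :: "real \<Rightarrow> real \<Rightarrow> real \<Rightarrow> nat \<Rightarrow> real" where
  "dig_sd \<sigma> \<rho> \<phi> 0 = 0"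
| "dig_sd \<sigma> \<rho> \<phi> (Suc t) = sqrt ((\<phi> * dig_sd \<sigma> \<rho> \<phi> t + \<rho> * \<sigma>)\<^sup>2 + (\<sigma> * sqrt (1 - \<rho>\<^sup>2))\<^sup>2)"

lemma V_bar_pos:
  assumes "\<bar>\<phi>\<bar> < 1" and "\<sigma> > 0"
  shows "V_bar \<sigma> \<rho> \<phi> > 0"
proof -
  have "\<phi>\<^sup>2 < 1"
    using assms by (simp add: abs_square_less_1)
  have "\<bar>\<rho> * \<phi>\<bar> < sqrt (\<rho>\<^sup>2 * \<phi>\<^sup>2 + 1 - \<phi>\<^sup>2)"
    using \<open>\<phi>\<^sup>2 < 1\<close> by (intro real_less_rsqrt) (simp add: power_mult_distrib)
  then show ?thesis
    using \<open>\<phi>\<^sup>2 < 1\<close> \<open>\<sigma> > 0\<close> by (simp add: V_bar_def)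
qed

text \<open>\<open>V_bar\<close> is the positive root of \<open>(1 - \<phi>\<^sup>2) x\<^sup>2 = 2 \<phi> \<rho> \<sigma> x + \<sigma>\<^sup>2\<close>.\<close>

lemma V_bar_fixed_point:
  assumes "\<bar>\<phi>\<bar> < 1" and "\<bar>\<rho>\<bar> < 1" and "\<sigma> > 0"
  shows "sqrt ((\<phi> * V_bar \<sigma> \<rho> \<phi> + \<rho> * \<sigma>)\<^sup>2 + (\<sigma> * sqrt (1 - \<rho>\<^sup>2))\<^sup>2) = V_bar \<sigma> \<rho> \<phi>"
proof (rule real_sqrt_unique)
  define d where "d = 1 - \<phi>\<^sup>2"
  define q where "q = sqrt (\<rho>\<^sup>2 * \<phi>\<^sup>2 + 1 - \<phi>\<^sup>2)"
  let ?V = "V_bar \<sigma> \<rho> \<phi>"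
  have "d > 0" "\<rho>\<^sup>2 < 1"
    using assms by (simp_all add: d_def abs_square_less_1)
  have "0 \<le> \<rho>\<^sup>2 * \<phi>\<^sup>2"
    by simp
  then have q: "q\<^sup>2 = \<rho>\<^sup>2 * \<phi>\<^sup>2 + d"
    using \<open>d > 0\<close> unfolding q_def d_def by (subst real_sqrt_pow2) linarith+
  have dV: "d * ?V = \<sigma> * (\<rho> * \<phi> + q)"
    using \<open>d > 0\<close> unfolding V_bar_def q_def[symmetric] d_def[symmetric] by simp
  have "d * (d * ?V\<^sup>2) = (d * ?V)\<^sup>2"
    by (simp add: power2_eq_square)
  also have "\<dots> = \<sigma>\<^sup>2 * (\<rho>\<^sup>2 * \<phi>\<^sup>2 + 2 * \<rho> * \<phi> * q + q\<^sup>2)"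
    unfolding dV by (simp add: power2_eq_square algebra_simps)
  also have "\<dots> = 2 * \<phi> * \<rho> * \<sigma> * (\<sigma> * (\<rho> * \<phi> + q)) + d * \<sigma>\<^sup>2"
    unfolding q by (simp add: power2_eq_square algebra_simps)
  also have "\<dots> = d * (2 * \<phi> * \<rho> * \<sigma> * ?V + \<sigma>\<^sup>2)"
    unfolding dV[symmetric] by (simp add: algebra_simps)
  finally have "d * ?V\<^sup>2 = 2 * \<phi> * \<rho> * \<sigma> * ?V + \<sigma>\<^sup>2"
    using \<open>d > 0\<close> by simp
  then have "?V\<^sup>2 = \<phi>\<^sup>2 * ?V\<^sup>2 + 2 * \<phi> * \<rho> * \<sigma> * ?V + \<sigma>\<^sup>2"
    by (simp add: d_def left_diff_distrib)
  also have "\<dots> = (\<phi> * ?V + \<rho> * \<sigma>)\<^sup>2 + (\<sigma> * sqrt (1 - \<rho>\<^sup>2))\<^sup>2"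
    using \<open>\<rho>\<^sup>2 < 1\<close> by (simp add: power2_sum power_mult_distrib algebra_simps)
  finally show "?V\<^sup>2 = (\<phi> * ?V + \<rho> * \<sigma>)\<^sup>2 + (\<sigma> * sqrt (1 - \<rho>\<^sup>2))\<^sup>2" .
  show "0 \<le> ?V"
    using V_bar_pos[of \<phi> \<sigma> \<rho>] assms by simp
qed

text \<open>The recursion maps \<open>v\<close> to the length of the vector \<open>(\<phi> v + \<rho> \<sigma>, \<sigma> sqrt (1 - \<rho>\<^sup>2))\<close>. Lengths of two
vectors differ by at most the length of their difference, so that the recursion is a contraction with
factor \<open>\<bar>\<phi>\<bar>\<close>. The vectors are represented as complex numbers.\<close>

lemma dig_sd_tendsto:
  assumes "\<bar>\<phi>\<bar> < 1" and "\<bar>\<rho>\<bar> < 1" and "\<sigma> > 0"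
  shows "dig_sd \<sigma> \<rho> \<phi> \<longlonglongrightarrow> V_bar \<sigma> \<rho> \<phi>"
proof -
  define b where "b = \<sigma> * sqrt (1 - \<rho>\<^sup>2)"
  let ?V = "V_bar \<sigma> \<rho> \<phi>"
  define step where "step v = cmod (Complex (\<phi> * v + \<rho> * \<sigma>) b)" for v
  have contraction: "\<bar>step v - step w\<bar> \<le> \<bar>\<phi>\<bar> * \<bar>v - w\<bar>" for v w
  proof -
    have "\<bar>step v - step w\<bar> \<le> cmod (Complex (\<phi> * v + \<rho> * \<sigma>) b - Complex (\<phi> * w + \<rho> * \<sigma>) b)"
      unfolding step_def by (rule norm_triangle_ineq3)
    also have "\<dots> = \<bar>\<phi> * (v - w)\<bar>"
      by (simp add: cmod_def right_diff_distrib)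
    finally show ?thesis
      by (simp add: abs_mult)
  qed
  have V: "step ?V = ?V"
    using V_bar_fixed_point[OF assms] by (simp add: step_def complex_norm b_def)
  have bound: "norm (dig_sd \<sigma> \<rho> \<phi> t - ?V) \<le> \<bar>\<phi>\<bar> ^ t * \<bar>?V\<bar>" for t
    unfolding real_norm_def
  proof (induction t)
    case (Suc t)
    have "\<bar>dig_sd \<sigma> \<rho> \<phi> (Suc t) - ?V\<bar> = \<bar>step (dig_sd \<sigma> \<rho> \<phi> t) - step ?V\<bar>"
      unfolding V by (simp add: step_def complex_norm b_def)
    also have "\<dots> \<le> \<bar>\<phi>\<bar> * \<bar>dig_sd \<sigma> \<rho> \<phi> t - ?V\<bar>"
      by (rule contraction)
    also have "\<dots> \<le> \<bar>\<phi>\<bar> * (\<bar>\<phi>\<bar> ^ t * \<bar>?V\<bar>)"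
      using Suc.IH by (rule mult_left_mono) simp
    finally show ?case
      by (simp add: mult.assoc)
  qed simp
  have "(\<lambda>t. \<bar>\<phi>\<bar> ^ t * \<bar>?V\<bar>) \<longlonglongrightarrow> 0"
    using assms by (intro tendsto_mult_left_zero LIMSEQ_power_zero) simp
  then have "(\<lambda>t. dig_sd \<sigma> \<rho> \<phi> t - ?V) \<longlonglongrightarrow> 0"
    by (rule Lim_null_comparison[rotated]) (intro always_eventually allI bound)
  then show ?thesis
    by (simp add: LIM_zero_iff)
qed

section \<open>Laws and moments of the process\<close>

lemma distributed_cong_AE:
  assumes "distributed M N X f" and "AE \<omega> in M. X \<omega> = X' \<omega>" and "X' \<in> measurable M N"
  shows "distributed M N X' f"
proof -
  have "distr M N X' = distr M N X"
    using assms by (intro distr_cong_AE) (auto simp: distributed_def)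
  with assms show ?thesis
    by (simp add: distributed_def)
qed

lemma integrable_mult_of_power2:
  fixes f g :: "'a \<Rightarrow> real"
  assumes [measurable]: "f \<in> borel_measurable M" "g \<in> borel_measurable M"
    and "integrable M (\<lambda>x. (f x)\<^sup>2)" "integrable M (\<lambda>x. (g x)\<^sup>2)"
  shows "integrable M (\<lambda>x. f x * g x)"
proof (rule Bochner_Integration.integrable_bound)
  show "integrable M (\<lambda>x. (f x)\<^sup>2 + (g x)\<^sup>2)"
    using assms by simp
  have "norm (f x * g x) \<le> norm ((f x)\<^sup>2 + (g x)\<^sup>2)" for x
  proof -
    have "2 * \<bar>f x * g x\<bar> \<le> (f x)\<^sup>2 + (g x)\<^sup>2"
      using sum_squares_bound[of "\<bar>f x\<bar>" "\<bar>g x\<bar>"] by (simp add: abs_mult mult.assoc)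
    then show ?thesis
      unfolding real_norm_def by linarith
  qed
  then show "AE x in M. norm (f x * g x) \<le> norm ((f x)\<^sup>2 + (g x)\<^sup>2)"
    by simp
qed measurable

context DIG_AR1
begin

declare random_variable_Y [measurable]

abbreviation "v \<equiv> dig_sd \<sigma> \<rho> \<phi>"

lemma residual_sd_pos: "\<sigma> * sqrt (1 - \<rho>\<^sup>2) > 0"
  using rho sigma by (simp add: abs_square_less_1)

lemma dig_sd_pos: "v (Suc t) > 0"
  using add_nonneg_pos[OF zero_le_power2 zero_less_power[OF residual_sd_pos]]
  by (simp only: dig_sd.simps real_sqrt_gt_0_iff)

text \<open>Of the three summands of \<open>Y (t + 1) = \<phi> Y t + (\<rho> \<sigma> / V\<^sub>t) Y t + \<sigma> sqrt (1 - \<rho>\<^sup>2) W\<close> the last two come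
from \<open>\<xi> (t + 1)\<close>. The hypothesis on the law of \<open>Y t\<close> is what the induction below establishes.\<close>

lemma Y_Suc_regression:
  assumes "distributed M lborel (Y t) (normal_density 0 (v t))" and "v t > 0"
  obtains W where "indep_var borel W borel (Y t)" "distributed M lborel W std_normal_density"
    "AE \<omega> in M. Y (Suc t) \<omega> = (\<phi> + \<rho> * \<sigma> / v t) * Y t \<omega> + \<sigma> * sqrt (1 - \<rho>\<^sup>2) * W \<omega>"
proof -
  obtain W where W: "indep_var borel W borel (Y t)" "distributed M lborel W std_normal_density"
    "\<And>\<omega>. \<xi> (Suc t) \<omega> = \<rho> * \<sigma> / v t * Y t \<omega> + \<sigma> * sqrt (1 - \<rho>\<^sup>2) * W \<omega>"
    using gaussian_copula_regression[OF xi_normal sigma assms _ rho, of "Suc t" thesis]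
      xi_Y_copula[of "Suc t"] by auto
  have "AE \<omega> in M. Y (Suc t) \<omega> = \<phi> * Y t \<omega> + \<xi> (Suc t) \<omega>"
    using Y_step[of "Suc t"] by simp
  then have "AE \<omega> in M. Y (Suc t) \<omega> = (\<phi> + \<rho> * \<sigma> / v t) * Y t \<omega> + \<sigma> * sqrt (1 - \<rho>\<^sup>2) * W \<omega>"
    by eventually_elim (simp add: W(3) algebra_simps)
  with W that show thesis by blast
qed

text \<open>Induction starts at time 1, because \<open>Y 0\<close> has no density and the copula condition on \<open>\<xi> 1\<close> is void.\<close>

lemma Y_normal: "distributed M lborel (Y (Suc t)) (normal_density 0 (v (Suc t)))"
proof (induction t)
  case 0
  have "\<rho>\<^sup>2 < 1"
    using rho by (simp add: abs_square_less_1)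
  then have "v (Suc 0) = \<sigma>"
    using sigma by (simp add: power_mult_distrib algebra_simps)
  moreover have "AE \<omega> in M. \<xi> (Suc 0) \<omega> = Y (Suc 0) \<omega>"
    using Y_0 Y_step[of "Suc 0", simplified] by eventually_elim simp
  ultimately show ?case
    using distributed_cong_AE[OF xi_normal[of "Suc 0"], of "Y (Suc 0)"] by simp
next
  case (Suc t)
  let ?v = "v (Suc t)"
  obtain W where W: "indep_var borel W borel (Y (Suc t))" "distributed M lborel W std_normal_density"
    "AE \<omega> in M. Y (Suc (Suc t)) \<omega> = (\<phi> + \<rho> * \<sigma> / ?v) * Y (Suc t) \<omega> + \<sigma> * sqrt (1 - \<rho>\<^sup>2) * W \<omega>"
    using Y_Suc_regression[OF Suc.IH dig_sd_pos] by blast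
  have "(\<phi> + \<rho> * \<sigma> / ?v) * ?v = \<phi> * ?v + \<rho> * \<sigma>"
    using dig_sd_pos[of t] by (simp add: distrib_right del: dig_sd.simps)
  then have "distributed M lborel (\<lambda>\<omega>. (\<phi> + \<rho> * \<sigma> / ?v) * Y (Suc t) \<omega> + \<sigma> * sqrt (1 - \<rho>\<^sup>2) * W \<omega>)
      (normal_density 0 (v (Suc (Suc t))))"
    using indep_normal_lincomb[OF W(1,2) Suc.IH dig_sd_pos residual_sd_pos, of "\<phi> + \<rho> * \<sigma> / ?v"]
    unfolding dig_sd.simps(2)[of _ _ _ "Suc t"] by (simp del: dig_sd.simps)
  moreover have "AE \<omega> in M. (\<phi> + \<rho> * \<sigma> / ?v) * Y (Suc t) \<omega> + \<sigma> * sqrt (1 - \<rho>\<^sup>2) * W \<omega> = Y (Suc (Suc t)) \<omega>"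
    using W(3) by eventually_elim (rule sym)
  ultimately show ?case
    by (rule distributed_cong_AE) simp
qed

lemma integrable_Y_mult: "integrable M (\<lambda>\<omega>. Y (Suc s) \<omega> * Y (Suc t) \<omega>)"
  by (rule integrable_mult_of_power2) (auto intro: normal_integrable_power2[OF Y_normal dig_sd_pos])

end

section \<open>The Markov case\<close>

text \<open>By the Markov property only \<open>Y t\<close> matters, and given \<open>Y t\<close> the residual of the regression averages to
zero.\<close>

lemma (in markov_DIG_AR1) cond_exp_Y_Suc:
  "AE \<omega> in M. real_cond_exp M (natural_filtration M Y (Suc t)) (Y (Suc (Suc t))) \<omega> =
     (\<phi> + \<rho> * \<sigma> / v (Suc t)) * Y (Suc t) \<omega>"
proof -
  let ?G = "vimage_algebra (space M) (Y (Suc t)) borel"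
  let ?a = "\<phi> + \<rho> * \<sigma> / v (Suc t)" and ?b = "\<sigma> * sqrt (1 - \<rho>\<^sup>2)"
  obtain W where W: "indep_var borel W borel (Y (Suc t))" "distributed M lborel W std_normal_density"
    "AE \<omega> in M. Y (Suc (Suc t)) \<omega> = ?a * Y (Suc t) \<omega> + ?b * W \<omega>"
    using Y_Suc_regression[OF Y_normal dig_sd_pos] by blast
  have [measurable]: "random_variable borel W"
    using W(1) by (rule indep_var_rv1)
  interpret G: finite_measure_subalgebra M ?G
    by unfold_locales (auto simp: subalgebra_def sets_vimage_algebra2)
  have "AE \<omega> in M. real_cond_exp M (natural_filtration M Y (Suc t)) (Y (Suc (Suc t))) \<omega> =
      real_cond_exp M ?G (Y (Suc (Suc t))) \<omega>"
    by (rule markov_process_real_cond_exp)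
      (auto intro: markov normal_integrable_power2(1)[OF Y_normal dig_sd_pos])
  moreover have "AE \<omega> in M. real_cond_exp M ?G (Y (Suc (Suc t))) \<omega> =
      real_cond_exp M ?G (\<lambda>\<omega>. ?a * Y (Suc t) \<omega> + ?b * W \<omega>) \<omega>"
    using W(3) by (rule G.real_cond_exp_cong) measurable
  moreover have "AE \<omega> in M. real_cond_exp M ?G (\<lambda>\<omega>. ?a * Y (Suc t) \<omega> + ?b * W \<omega>) \<omega> = ?a * Y (Suc t) \<omega>"
  proof (rule cond_exp_indep_remainder[OF W(1)])
    show "integrable M W"
      using W(2) by (rule normal_integrable_power2(1)) simp
    show "expectation W = 0"
      using W(2) by (rule standard_normal_distributed_expectation)
    show "integrable M (Y (Suc t))"
      by (rule normal_integrable_power2(1)[OF Y_normal dig_sd_pos])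
  qed
  ultimately show ?thesis
    by eventually_elim simp
qed

lemma (in markov_DIG_AR1) expectation_Y_mult_Suc:
  assumes "s \<le> t"
  shows "expectation (\<lambda>\<omega>. Y (Suc s) \<omega> * Y (Suc (Suc t)) \<omega>) =
    (\<phi> + \<rho> * \<sigma> / v (Suc t)) * expectation (\<lambda>\<omega>. Y (Suc s) \<omega> * Y (Suc t) \<omega>)"
proof -
  let ?F = "natural_filtration M Y (Suc t)" and ?a = "\<phi> + \<rho> * \<sigma> / v (Suc t)"
  interpret F: finite_measure_subalgebra M ?F
    by unfold_locales (rule subalgebra_natural_filtration, rule random_variable_Y)
  have "expectation (\<lambda>\<omega>. Y (Suc s) \<omega> * Y (Suc (Suc t)) \<omega>)
      = expectation (\<lambda>\<omega>. Y (Suc s) \<omega> * real_cond_exp M ?F (Y (Suc (Suc t))) \<omega>)"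
    using integrable_Y_mult \<open>s \<le> t\<close>
    by (intro F.real_cond_exp_intg(2)[symmetric] measurable_natural_filtration random_variable_Y) auto
  also have "\<dots> = expectation (\<lambda>\<omega>. ?a * (Y (Suc s) \<omega> * Y (Suc t) \<omega>))"
  proof (rule integral_cong_AE)
    show "AE \<omega> in M. Y (Suc s) \<omega> * real_cond_exp M ?F (Y (Suc (Suc t))) \<omega> = ?a * (Y (Suc s) \<omega> * Y (Suc t) \<omega>)"
      using cond_exp_Y_Suc[of t] by eventually_elim (simp only: mult.left_commute)
  qed measurable
  finally show ?thesis
    by (simp del: dig_sd.simps)
qed

text \<open>Raising the lag from \<open>j\<close> to \<open>j + 1\<close> multiplies the moment by \<open>\<phi> + \<rho> \<sigma> / V\<^bsub>t+j\<^esub>\<close>, whose limit is \<open>tau_bar\<close>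
because \<open>V_bar\<close> is positive.\<close>

lemma (in markov_DIG_AR1) expectation_Y_mult_tendsto:
  "(\<lambda>t. expectation (\<lambda>\<omega>. Y t \<omega> * Y (t + j) \<omega>)) \<longlonglongrightarrow> (V_bar \<sigma> \<rho> \<phi>)\<^sup>2 * tau_bar \<sigma> \<rho> \<phi> ^ j"
proof -
  note v = dig_sd_tendsto[OF phi rho sigma]
  have "(\<lambda>t. expectation (\<lambda>\<omega>. Y (Suc t) \<omega> * Y (Suc (t + j)) \<omega>)) \<longlonglongrightarrow> (V_bar \<sigma> \<rho> \<phi>)\<^sup>2 * tau_bar \<sigma> \<rho> \<phi> ^ j"
  proof (induction j)
    case 0
    have "(\<lambda>t. (v (Suc t))\<^sup>2) \<longlonglongrightarrow> (V_bar \<sigma> \<rho> \<phi>)\<^sup>2"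
      using v[THEN LIMSEQ_Suc] by (rule tendsto_power)
    then show ?case
      by (simp add: normal_integrable_power2(3)[OF Y_normal dig_sd_pos] power2_eq_square[symmetric] del: dig_sd.simps)
  next
    case (Suc j)
    have "(\<lambda>t. \<phi> + \<rho> * \<sigma> / v (t + Suc j)) \<longlonglongrightarrow> tau_bar \<sigma> \<rho> \<phi>"
      unfolding tau_bar_def using LIMSEQ_ignore_initial_segment[OF v, of "Suc j"] V_bar_pos[OF phi sigma, of \<rho>]
      by (intro tendsto_intros) auto
    with Suc.IH have "(\<lambda>t. expectation (\<lambda>\<omega>. Y (Suc t) \<omega> * Y (Suc (t + j)) \<omega>) * (\<phi> + \<rho> * \<sigma> / v (t + Suc j)))
        \<longlonglongrightarrow> (V_bar \<sigma> \<rho> \<phi>)\<^sup>2 * tau_bar \<sigma> \<rho> \<phi> ^ j * tau_bar \<sigma> \<rho> \<phi>"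
      by (rule tendsto_mult)
    moreover have "expectation (\<lambda>\<omega>. Y (Suc t) \<omega> * Y (Suc (t + j)) \<omega>) * (\<phi> + \<rho> * \<sigma> / v (t + Suc j))
        = expectation (\<lambda>\<omega>. Y (Suc t) \<omega> * Y (Suc (t + Suc j)) \<omega>)" for t
      using expectation_Y_mult_Suc[of t "t + j"] by (simp only: add_Suc_right le_add1 mult.commute)
    ultimately show ?case
      by (simp only: power_Suc2 mult.assoc)
  qed
  then show ?thesis
    by (subst filterlim_sequentially_Suc[symmetric]) simp
qed

lemma (in DIG_AR1) correlation_innovations:
  "correlation (\<xi> (Suc s)) (\<xi> (Suc t)) = expectation (\<lambda>\<omega>. \<xi> (Suc s) \<omega> * \<xi> (Suc t) \<omega>) / \<sigma>\<^sup>2"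
proof -
  have "expectation (\<xi> (Suc u)) = 0" "variance (\<xi> (Suc u)) = \<sigma>\<^sup>2" for u
    using normal_distributed_expectation[OF sigma xi_normal[of "Suc u"]]
      normal_distributed_variance[OF sigma xi_normal[of "Suc u"]] by simp_all
  then show ?thesis
    using sigma unfolding correlation_def covariance_def by (simp only:) (simp add: power2_eq_square)
qed

lemma (in DIG_AR1) expectation_innovations_mult:
  "expectation (\<lambda>\<omega>. \<xi> (Suc (Suc s)) \<omega> * \<xi> (Suc (Suc t)) \<omega>) =
    expectation (\<lambda>\<omega>. Y (Suc (Suc s)) \<omega> * Y (Suc (Suc t)) \<omega>)
    - \<phi> * expectation (\<lambda>\<omega>. Y (Suc (Suc s)) \<omega> * Y (Suc t) \<omega>)
    - \<phi> * expectation (\<lambda>\<omega>. Y (Suc s) \<omega> * Y (Suc (Suc t)) \<omega>)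
    + \<phi>\<^sup>2 * expectation (\<lambda>\<omega>. Y (Suc s) \<omega> * Y (Suc t) \<omega>)"
proof -
  have [measurable]: "random_variable borel (\<xi> (Suc t))" for t
    using distributed_measurable[OF xi_normal[of "Suc t"]] by simp
  have "expectation (\<lambda>\<omega>. \<xi> (Suc (Suc s)) \<omega> * \<xi> (Suc (Suc t)) \<omega>) =
    expectation (\<lambda>\<omega>. Y (Suc (Suc s)) \<omega> * Y (Suc (Suc t)) \<omega>
      - \<phi> * (Y (Suc (Suc s)) \<omega> * Y (Suc t) \<omega>)
      - \<phi> * (Y (Suc s) \<omega> * Y (Suc (Suc t)) \<omega>)
      + \<phi>\<^sup>2 * (Y (Suc s) \<omega> * Y (Suc t) \<omega>))"
  proof (rule integral_cong_AE)
    have "AE \<omega> in M. \<xi> (Suc (Suc t)) \<omega> = Y (Suc (Suc t)) \<omega> - \<phi> * Y (Suc t) \<omega>" for t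
      using Y_step[of "Suc (Suc t)", simplified] by eventually_elim simp
    from this[of s] this[of t]
    show "AE \<omega> in M. \<xi> (Suc (Suc s)) \<omega> * \<xi> (Suc (Suc t)) \<omega> =
      Y (Suc (Suc s)) \<omega> * Y (Suc (Suc t)) \<omega>
      - \<phi> * (Y (Suc (Suc s)) \<omega> * Y (Suc t) \<omega>)
      - \<phi> * (Y (Suc s) \<omega> * Y (Suc (Suc t)) \<omega>)
      + \<phi>\<^sup>2 * (Y (Suc s) \<omega> * Y (Suc t) \<omega>)"
      by eventually_elim (simp only:, simp add: power2_eq_square algebra_simps)
  qed measurable
  then show ?thesis
    by (simp add: integrable_Y_mult)
qed

text \<open>In the limit, the four moments of \<open>expectation_innovations_mult\<close> for the lag \<open>k\<close> contribute
\<open>V\<^sup>2 (\<tau>\<^sup>k - \<phi> \<tau>\<^bsup>k-1\<^esup> - \<phi> \<tau>\<^bsup>k+1\<^esup> + \<phi>\<^sup>2 \<tau>\<^sup>k)\<close>, which is \<open>V\<^sup>2 \<tau>\<^bsup>k-1\<^esup> (\<tau> - \<phi>) (1 - \<phi> \<tau>)\<close>; here \<open>V\<close> and \<open>\<tau>\<close>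
stand for \<open>V_bar\<close> and \<open>tau_bar\<close>.\<close>

theorem proposition3p2:
  fixes M :: "'a measure" and Y \<xi> :: "nat \<Rightarrow> 'a \<Rightarrow> real" and \<phi> \<rho> \<sigma> :: real and k :: nat
  assumes "\<bar>\<phi>\<bar> < 1" and "\<bar>\<rho>\<bar> < 1" and "\<sigma> > 0"
    and "markov_DIG_AR1 M Y \<xi> \<phi> \<rho> \<sigma>"
    and "k \<ge> 1"
  shows "(\<lambda>t. prob_space.correlation M (\<xi> t) (\<xi> (t + k))) \<longlonglongrightarrow>
    (V_bar \<sigma> \<rho> \<phi>)\<^sup>2 * tau_bar \<sigma> \<rho> \<phi> ^ (k - 1) / \<sigma>\<^sup>2
      * (tau_bar \<sigma> \<rho> \<phi> - \<phi>) * (1 - \<phi> * tau_bar \<sigma> \<rho> \<phi>)"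
proof -
  interpret markov_DIG_AR1 M Y \<xi> \<phi> \<rho> \<sigma> by fact
  obtain j where k: "k = Suc j"
    using \<open>k \<ge> 1\<close> by (cases k) auto
  let ?V = "V_bar \<sigma> \<rho> \<phi>" and ?\<tau> = "tau_bar \<sigma> \<rho> \<phi>"
  let ?m = "\<lambda>j t. expectation (\<lambda>\<omega>. Y t \<omega> * Y (t + j) \<omega>)"
  have m: "?m j \<longlonglongrightarrow> ?V\<^sup>2 * ?\<tau> ^ j" for j
    by (rule expectation_Y_mult_tendsto)
  \<comment> \<open>The time is shifted by 2 so that both \<open>Y t\<close> and \<open>Y (t - 1)\<close> have a normal density.\<close>
  have "(\<lambda>t. (?m (Suc j) (t + 2) - \<phi> * ?m j (t + 2) - \<phi> * ?m (Suc (Suc j)) (t + 1)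
        + \<phi>\<^sup>2 * ?m (Suc j) (t + 1)) / \<sigma>\<^sup>2)
      \<longlonglongrightarrow> (?V\<^sup>2 * ?\<tau> ^ Suc j - \<phi> * (?V\<^sup>2 * ?\<tau> ^ j) - \<phi> * (?V\<^sup>2 * ?\<tau> ^ Suc (Suc j))
        + \<phi>\<^sup>2 * (?V\<^sup>2 * ?\<tau> ^ Suc j)) / \<sigma>\<^sup>2"
    using sigma by (intro tendsto_intros LIMSEQ_ignore_initial_segment[OF m]) auto
  also have "(\<lambda>t. (?m (Suc j) (t + 2) - \<phi> * ?m j (t + 2) - \<phi> * ?m (Suc (Suc j)) (t + 1)
        + \<phi>\<^sup>2 * ?m (Suc j) (t + 1)) / \<sigma>\<^sup>2) = (\<lambda>t. correlation (\<xi> (t + 2)) (\<xi> (t + 2 + k)))"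
  proof (rule ext)
    fix t
    show "(?m (Suc j) (t + 2) - \<phi> * ?m j (t + 2) - \<phi> * ?m (Suc (Suc j)) (t + 1)
        + \<phi>\<^sup>2 * ?m (Suc j) (t + 1)) / \<sigma>\<^sup>2 = correlation (\<xi> (t + 2)) (\<xi> (t + 2 + k))"
      using expectation_innovations_mult[of t "t + Suc j"] correlation_innovations[of "Suc t" "Suc (t + Suc j)"]
      by (simp add: k)
  qed
  also have "(?V\<^sup>2 * ?\<tau> ^ Suc j - \<phi> * (?V\<^sup>2 * ?\<tau> ^ j) - \<phi> * (?V\<^sup>2 * ?\<tau> ^ Suc (Suc j))
        + \<phi>\<^sup>2 * (?V\<^sup>2 * ?\<tau> ^ Suc j)) / \<sigma>\<^sup>2
      = ?V\<^sup>2 * ?\<tau> ^ (k - 1) / \<sigma>\<^sup>2 * (?\<tau> - \<phi>) * (1 - \<phi> * ?\<tau>)"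
  proof -
    have "?V\<^sup>2 * ?\<tau> ^ Suc j - \<phi> * (?V\<^sup>2 * ?\<tau> ^ j) - \<phi> * (?V\<^sup>2 * ?\<tau> ^ Suc (Suc j))
        + \<phi>\<^sup>2 * (?V\<^sup>2 * ?\<tau> ^ Suc j) = ?V\<^sup>2 * ?\<tau> ^ j * (?\<tau> - \<phi>) * (1 - \<phi> * ?\<tau>)"
      by (simp add: power2_eq_square algebra_simps)
    then show ?thesis
      by (simp add: k)
  qed
  finally show ?thesis
    by (rule LIMSEQ_offset)
qed

end
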